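(* Let $X$ be a Banach space over $\mathbb{K}\in\{\mathbb{R},\mathbb{C}\}$, let $\Lambda$ be a nonempty set, let $X_\lambda$, $\lambda\in\Lambda$, be closed linear subspaces of $X$, and let $Y$ be a closed linear subspace of $X$. Suppose that for every $\delta>0$ there exists a closed linear subspace $L$ of $X$ with $L\subset\mathcal{L}(X_\lambda\mid\lambda\in\Lambda)$ and $\rho_0(Y,L)<\delta$. If there exists $\varepsilon>0$ such that $$\sup_{\lambda\in\Lambda}\|\varphi\upharpoonright_{X_\lambda}\|\geqslant\varepsilon\|\varphi\|\quad\text{for every }\varphi\in Y^{\bot},$$ then the family $(X_\lambda)_{\lambda\in\Lambda}$ is an absolutely representing family of subspaces (ARFS) in $X$.
   Context: A family $(X_\lambda)_{\lambda\in\Lambda}$ of closed linear subspaces of $X$ is called an absolutely representing family of subspaces (ARFS) in $X$ if for every $x\in X$ there exist $x_\lambda\in X_\lambda$, $\lambda\in\Lambda$, such that $\sum_{\lambda\in\Lambda}\|x_\lambda\|<\infty$ and $x=\sum_{\lambda\in\Lambda}x_\lambda$. $\mathcal{L}(X_\lambda\mid\lambda\in\Lambda)$ is the (algebraic, not closed) linear span of $\bigcup_{\lambda\in\Lambda}X_\lambda$. For closed linear subspaces $Y,Z\subset X$, $\rho_0(Y,Z)=\sup\{d(y,Z)\mid y\in Y,\ \|y\|=1\}$, where $d(y,Z)=\inf_{z\in Z}\|y-z\|$; if $Y=\{0\}$, then $\rho_0(Y,Z)=0$. $Y^{\bot}=\{\varphi\in X^*\mid\varphi\upharpoonright_Y=0\}$,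 and $\|\varphi\upharpoonright_{X_\lambda}\|$ is the norm of the restriction of $\varphi$ to $X_\lambda$ as an element of $X_\lambda^*$ (equal to $0$ if $X_\lambda=\{0\}$). *)

theory Defs
  imports "HOL-Analysis.Analysis"
begin

text \<open>The scalar field: a normed field isometrically isomorphic to the reals or to the complex
  numbers. (That \<open>f\<close> is injective and maps 1 to 1 follows from \<open>f\<close> being isometric.)\<close>

class real_or_complex = real_normed_field +
  assumes real_or_complex:
    "\<exists>f :: 'a \<Rightarrow> complex.
       (\<forall>x y. f (x + y) = f x + f y) \<and> (\<forall>x y. f (x * y) = f x * f y) \<and>
       (\<forall>r x. f (r *\<^sub>R x) = r *\<^sub>R f x) \<and> (\<forall>x. norm (f x) = norm x) \<and>
       (range f = \<real> \<or> range f = UNIV)"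

instance real :: real_or_complex
  by standard (rule exI[of _ complex_of_real], auto simp: Reals_def scaleR_conv_of_real)

instance complex :: real_or_complex
  by standard (rule exI[of _ id], auto)

text \<open>A Banach space over the scalar field \<open>'k\<close>. The norm and the completeness come from the type
  class \<^class>\<open>banach\<close>, which also fixes a multiplication by reals; the multiplication by elements
  of \<open>'k\<close> has to extend it.\<close>

locale banach_space_over = vector_space scaleK
  for scaleK :: "'k::real_or_complex \<Rightarrow> 'x::banach \<Rightarrow> 'x" +
  assumes scale_of_real: "scaleK (of_real r) x = r *\<^sub>R x"
    and norm_scale: "norm (scaleK c x) = norm c * norm x"

lemma banach_space_over_scaleR: "banach_space_over (scaleR :: real \<Rightarrow> 'x::banach \<Rightarrow> 'x)"
  by unfold_locales (auto simp: algebra_simps)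

lemma banach_space_over_complex: "banach_space_over ((*) :: complex \<Rightarrow> complex \<Rightarrow> complex)"
  by unfold_locales (auto simp: algebra_simps norm_mult scaleR_conv_of_real)

definition closed_subspace :: "('k::real_or_complex \<Rightarrow> 'x::banach \<Rightarrow> 'x) \<Rightarrow> 'x set \<Rightarrow> bool"
  where "closed_subspace scaleK S \<longleftrightarrow> module.subspace scaleK S \<and> closed S"

definition dual_space :: "('k::real_or_complex \<Rightarrow> 'x::banach \<Rightarrow> 'x) \<Rightarrow> ('x \<Rightarrow> 'k) set"
  where "dual_space scaleK = {\<phi>. bounded_linear \<phi> \<and> (\<forall>c x. \<phi> (scaleK c x) = c * \<phi> x)}"

definition annihilator ::
    "('k::real_or_complex \<Rightarrow> 'x::banach \<Rightarrow> 'x) \<Rightarrow> 'x set \<Rightarrow> ('x \<Rightarrow> 'k) set"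
  where "annihilator scaleK Y = {\<phi> \<in> dual_space scaleK. \<forall>y\<in>Y. \<phi> y = 0}"

text \<open>The norm of the restriction of \<open>\<phi>\<close> to the subspace \<open>S\<close>, in the form used by \<^const>\<open>onorm\<close>;
  since \<open>0 / 0 = 0\<close>, it is 0 for \<open>S = {0}\<close>.\<close>

definition onorm_on :: "'x::real_normed_vector set \<Rightarrow> ('x \<Rightarrow> 'k::real_normed_vector) \<Rightarrow> real"
  where "onorm_on S \<phi> = (SUP x\<in>S. norm (\<phi> x) / norm x)"

lemma onorm_on_UNIV: "onorm_on UNIV \<phi> = onorm \<phi>"
  by (simp add: onorm_on_def onorm_def)

text \<open>For subspaces \<open>Y\<close>, \<open>Z\<close> the supremum is over a set bounded by 1, which is empty only if
  \<open>Y = {0}\<close>.\<close>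

definition rho0 :: "'x::real_normed_vector set \<Rightarrow> 'x set \<Rightarrow> real"
  where "rho0 Y Z = (if Y = {0} then 0 else Sup {infdist y Z | y. y \<in> Y \<and> norm y = 1})"

definition ARFS ::
    "('k::real_or_complex \<Rightarrow> 'x::banach \<Rightarrow> 'x) \<Rightarrow> 'i set \<Rightarrow> ('i \<Rightarrow> 'x set) \<Rightarrow> bool"
  where "ARFS scaleK \<Lambda> X \<longleftrightarrow>
    (\<forall>l\<in>\<Lambda>. closed_subspace scaleK (X l)) \<and>
    (\<forall>x. \<exists>f. (\<forall>l\<in>\<Lambda>. f l \<in> X l) \<and> (\<lambda>l. norm (f l)) summable_on \<Lambda> \<and> (f has_sum x) \<Lambda>)"

end

theory Submission
  imports Defs
begin

text \<open>Call the total norm of the summands the cost of a finite sum of elements of the \<open>X l\<close>. By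
  Hahn-Banach, the bound on \<open>annihilator scaleK Y\<close> shows that every \<open>x\<close> is, up to an error of
  \<open>norm x / 4\<close>, a finite sum of cost at most \<open>2 / \<epsilon> * norm x\<close> plus an element \<open>y\<close> of \<open>Y\<close>, whose norm
  is therefore controlled as well. If \<open>rho0 Y L\<close> is small, \<open>y\<close> is close to some \<open>l\<close> in \<open>L\<close>. By
  Baire's theorem in the Banach space \<open>L\<close>, which is the union of the sets of its elements of cost at
  most \<open>n\<close>, elements \<open>l\<close> of \<open>L\<close> are limits of finite sums of cost at most \<open>K * norm l\<close>. Hence every
  \<open>x\<close> is within \<open>norm x / 2\<close> of a finite sum of cost \<open>O (norm x)\<close>, and iterating on the error gives
  an absolutely convergent representation of \<open>x\<close>.\<close>

subsection \<open>The Hahn-Banach theorem for seminorms over the scalar field\<close>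

text \<open>Positive homogeneity is asked only as an inequality, which is what the infima below
  deliver directly; equality follows by scaling back with \<open>inverse t\<close>.\<close>

definition sublinear :: "('x::real_vector \<Rightarrow> real) \<Rightarrow> bool"
  where "sublinear p \<longleftrightarrow>
    (\<forall>x y. p (x + y) \<le> p x + p y) \<and> (\<forall>t x. t \<ge> 0 \<longrightarrow> p (t *\<^sub>R x) \<le> t * p x)"

lemma sublinear_add: "sublinear p \<Longrightarrow> p (x + y) \<le> p x + p y"
  by (simp add: sublinear_def)

lemma sublinear_zero: "sublinear p \<Longrightarrow> p 0 = 0"
  unfolding sublinear_def
  by (metis add.right_neutral add_le_cancel_left mult_zero_left order_antisym order_refl scaleR_zero_left)

lemma sublinear_scaleR:
  assumes "sublinear p" "t \<ge> 0"
  shows "p (t *\<^sub>R x) = t * p x"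
proof (cases "t = 0")
  case False
  with \<open>t \<ge> 0\<close> have "t > 0" by simp
  have "p (inverse t *\<^sub>R (t *\<^sub>R x)) \<le> inverse t * p (t *\<^sub>R x)"
    using assms \<open>t > 0\<close> unfolding sublinear_def by (metis inverse_nonnegative_iff_nonnegative)
  then have "t * p x \<le> p (t *\<^sub>R x)"
    using \<open>t > 0\<close> by (simp add: field_simps)
  moreover have "p (t *\<^sub>R x) \<le> t * p x"
    using assms by (simp add: sublinear_def)
  ultimately show ?thesis by simp
qed (simp add: sublinear_zero[OF assms(1)])

lemma sublinear_minus: "sublinear p \<Longrightarrow> - p (- x) \<le> p x"
  using sublinear_add[of p x "- x"] sublinear_zero[of p] by simp

text \<open>This lowers \<open>p\<close> to a sublinear functional that is as small as linearity
  would demand at \<open>- y\<close>. The infimum is finite because \<open>t * p y = p (t *\<^sub>R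
  y) \<le> p (x + t *\<^sub>R y) + p (- x)\<close>; the parameters \<open>t = 0\<close> and
  \<open>t = 1\<close> give the two upper bounds.\<close>

lemma sublinear_INF_shift:
  fixes p :: "'x::real_vector \<Rightarrow> real" and y :: 'x
  assumes p: "sublinear p"
  defines "q \<equiv> \<lambda>x. INF t\<in>{0..}. p (x + t *\<^sub>R y) - t * p y"
  shows "sublinear q" and "q x \<le> p x" and "q (- y) \<le> - p y"
proof -
  have bdd: "bdd_below ((\<lambda>t. p (x + t *\<^sub>R y) - t * p y) ` {0..})" for x
  proof (rule bdd_belowI2)
    fix t :: real assume "t \<in> {0..}"
    then have "t * p y = p (t *\<^sub>R y)" using sublinear_scaleR[OF p, of t y] by simp
    also have "\<dots> \<le> p (x + t *\<^sub>R y) + p (- x)"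
      using sublinear_add[OF p, of "x + t *\<^sub>R y" "- x"] by simp
    finally show "- p (- x) \<le> p (x + t *\<^sub>R y) - t * p y" by simp
  qed
  have le: "q x \<le> p (x + t *\<^sub>R y) - t * p y" if "t \<ge> 0" for x t
    unfolding q_def using that by (intro cINF_lower bdd) auto
  have greatest: "m \<le> q x" if "\<And>t. t \<ge> 0 \<Longrightarrow> m \<le> p (x + t *\<^sub>R y) - t * p y" for m x
    unfolding q_def using that by (intro cINF_greatest) auto
  show "q x \<le> p x" for x using le[of 0 x] by simp
  then have q0: "q 0 \<le> 0" by (metis p sublinear_zero)
  show "q (- y) \<le> - p y" using le[of 1 "- y"] sublinear_zero[OF p] by simp
  show "sublinear q"
    unfolding sublinear_def
  proof (intro conjI allI impI)
    fix x z
    have "q (x + z) - (p (z + t *\<^sub>R y) - t * p y) \<le> q x" if "t \<ge> 0" for t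
    proof (rule greatest)
      fix s :: real assume "s \<ge> 0"
      \<comment> \<open>Parameters \<open>s\<close> for \<open>x\<close> and \<open>t\<close> for
        \<open>z\<close> combine to the parameter \<open>s + t\<close> for
        \<open>x + z\<close>.\<close>
      have "q (x + z) \<le> p ((x + s *\<^sub>R y) + (z + t *\<^sub>R y)) - (s + t) * p y"
        using le[of "s + t" "x + z"] \<open>s \<ge> 0\<close> \<open>t \<ge> 0\<close> by (simp add: algebra_simps)
      with sublinear_add[OF p, of "x + s *\<^sub>R y" "z + t *\<^sub>R y"]
      show "q (x + z) - (p (z + t *\<^sub>R y) - t * p y) \<le> p (x + s *\<^sub>R y) - s * p y"
        by (simp add: algebra_simps)
    qed
    then have "q (x + z) - q x \<le> q z"
      by (intro greatest) (simp add: algebra_simps)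
    then show "q (x + z) \<le> q x + q z" by simp
  next
    fix c :: real and x assume "c \<ge> 0"
    show "q (c *\<^sub>R x) \<le> c * q x"
    proof (cases "c = 0")
      case False
      with \<open>c \<ge> 0\<close> have "c > 0" by simp
      have "q (c *\<^sub>R x) / c \<le> q x"
      proof (rule greatest)
        fix t :: real assume "t \<ge> 0"
        have "q (c *\<^sub>R x) \<le> p (c *\<^sub>R (x + t *\<^sub>R y)) - c * t * p y"
          using le[of "c * t" "c *\<^sub>R x"] \<open>t \<ge> 0\<close> \<open>c > 0\<close> by (simp add: algebra_simps)
        also have "p (c *\<^sub>R (x + t *\<^sub>R y)) = c * p (x + t *\<^sub>R y)"
          using \<open>c > 0\<close> by (intro sublinear_scaleR p) simp
        finally show "q (c *\<^sub>R x) / c \<le> p (x + t *\<^sub>R y) - t * p y"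
          using \<open>c > 0\<close> by (simp add: field_simps)
      qed
      with \<open>c > 0\<close> show ?thesis by (simp add: field_simps)
    qed (simp add: q0)
  qed
qed

text \<open>Supplies the lower bounds for Zorn's lemma. The common bound \<open>p\<close> keeps the
  infimum finite, since \<open>- p (- x) \<le> q x\<close> for every \<open>q\<close> in
  \<open>C\<close>. Subadditivity rests on the chain condition: of two members \<open>q\<close> and
  \<open>r\<close>, the smaller one can serve for both summands.\<close>

lemma sublinear_INF_chain:
  fixes C :: "('x::real_vector \<Rightarrow> real) set"
  assumes "C \<noteq> {}" "\<And>q. q \<in> C \<Longrightarrow> sublinear q \<and> q \<le> p"
    and chain: "\<And>q r. q \<in> C \<Longrightarrow> r \<in> C \<Longrightarrow> q \<le> r \<or> r \<le> q"
  defines "u \<equiv> \<lambda>x. INF q\<in>C. q x"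
  shows "sublinear u" and "\<And>q. q \<in> C \<Longrightarrow> u \<le> q"
proof -
  have bdd: "bdd_below ((\<lambda>q. q x) ` C)" for x
  proof (rule bdd_belowI2)
    fix q assume "q \<in> C"
    with assms(2) have "sublinear q" "q (- x) \<le> p (- x)" by (auto simp: le_fun_def)
    with sublinear_minus[of q x] show "- p (- x) \<le> q x" by simp
  qed
  have le: "u x \<le> q x" if "q \<in> C" for q x
    unfolding u_def using that by (intro cINF_lower bdd)
  then show "u \<le> q" if "q \<in> C" for q using that by (simp add: le_fun_def)
  have greatest: "m \<le> u x" if "\<And>q. q \<in> C \<Longrightarrow> m \<le> q x" for m x
    unfolding u_def using that \<open>C \<noteq> {}\<close> by (intro cINF_greatest) auto
  show "sublinear u"
    unfolding sublinear_def
  proof (intro conjI allI impI)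
    fix x z
    have "u (x + z) \<le> q x + r z" if "q \<in> C" "r \<in> C" for q r
      using chain[OF that]
    proof
      assume "q \<le> r"
      then show ?thesis
        using le[of q "x + z"] sublinear_add[of q x z] assms(2)[of q] that
        by (smt (verit) le_funD)
    next
      assume "r \<le> q"
      then show ?thesis
        using le[of r "x + z"] sublinear_add[of r x z] assms(2)[of r] that
        by (smt (verit) le_funD)
    qed
    then have "u (x + z) - r z \<le> u x" if "r \<in> C" for r
      using that by (intro greatest) (simp add: algebra_simps)
    then have "u (x + z) - u x \<le> u z"
      by (intro greatest) (simp add: algebra_simps)
    then show "u (x + z) \<le> u x + u z" by simp
  next
    fix c :: real and x assume "c \<ge> 0"
    show "u (c *\<^sub>R x) \<le> c * u x"
    proof (cases "c = 0")
      case True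
      with \<open>C \<noteq> {}\<close> assms(2) le[of _ 0] show ?thesis
        by (metis all_not_in_conv mult_zero_left scaleR_zero_left sublinear_zero)
    next
      case False
      with \<open>c \<ge> 0\<close> have "c > 0" by simp
      have "u (c *\<^sub>R x) / c \<le> u x"
      proof (rule greatest)
        fix q assume "q \<in> C"
        then have "u (c *\<^sub>R x) \<le> c * q x"
          using le[of q "c *\<^sub>R x"] sublinear_scaleR[of q c x] assms(2) \<open>c > 0\<close> by auto
        then show "u (c *\<^sub>R x) / c \<le> q x" using \<open>c > 0\<close> by (simp add: field_simps)
      qed
      with \<open>c > 0\<close> show ?thesis by (simp add: field_simps)
    qed
  qed
qed

text \<open>A minimal sublinear functional \<open>u\<close> is linear: by minimality it agrees with each of its shifts
  from \<open>sublinear_INF_shift\<close>, whence \<open>u (- y) \<le> - u y\<close>. Starting the minimization at the shift of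
  \<open>p\<close> in direction \<open>x0\<close> forces \<open>u x0 = p x0\<close>.\<close>

lemma Hahn_Banach_sublinear:
  fixes p :: "'x::real_vector \<Rightarrow> real"
  assumes p: "sublinear p"
  obtains u where "linear u" "\<And>x. u x \<le> p x" "u x0 = p x0"
proof -
  define p0 where "p0 = (\<lambda>x. INF t\<in>{0..}. p (x + t *\<^sub>R x0) - t * p x0)"
  have p0: "sublinear p0" "\<And>x. p0 x \<le> p x" "p0 (- x0) \<le> - p x0"
    unfolding p0_def by (rule sublinear_INF_shift[OF p])+
  define A where "A = {q. sublinear q \<and> q \<le> p0}"
  have "\<exists>m\<in>A. \<forall>a\<in>A. m \<ge> a \<longrightarrow> a = m"
  \<comment> \<open>Zorn's lemma is used for the reversed order, so that the maximal element it
    yields is a minimal functional.\<close>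
  proof (rule predicate_Zorn)
    show "partial_order_on A (relation_of (\<ge>) A)"
      by (rule partial_order_on_relation_ofI) auto
  next
    fix C assume C: "C \<in> Chains (relation_of (\<ge>) A)"
    show "\<exists>u\<in>A. \<forall>a\<in>C. a \<ge> u"
    proof (cases "C = {}")
      case True
      with p0(1) show ?thesis by (auto simp: A_def)
    next
      case False
      have 1: "sublinear q \<and> q \<le> p0" if "q \<in> C" for q
        using C that by (auto simp: Chains_def relation_of_def A_def)
      have 2: "q \<le> r \<or> r \<le> q" if "q \<in> C" "r \<in> C" for q r
        using C that by (auto simp: Chains_def relation_of_def)
      note u = sublinear_INF_chain[OF False 1 2]
      from False obtain q where "q \<in> C" by blast
      with u 1 have "(\<lambda>x. INF q\<in>C. q x) \<in> A"
        unfolding A_def by (blast intro: order_trans)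
      with u(2) show ?thesis by blast
    qed
  qed
  then obtain u where u: "sublinear u" "u \<le> p0" and min: "\<And>q. sublinear q \<Longrightarrow> q \<le> u \<Longrightarrow> q = u"
    unfolding A_def using order_trans by blast
  have neg: "u (- y) = - u y" for y
  proof -
    note q = sublinear_INF_shift[OF u(1), where y = y]
    have "u (- y) \<le> - u y"
      using q(3) unfolding fun_cong[OF min[OF q(1) le_funI], OF q(2)] .
    with sublinear_minus[OF u(1), of "- y"] show ?thesis by simp
  qed
  \<comment> \<open>Subadditivity at \<open>- x\<close>, \<open>- y\<close> turns into
    superadditivity at \<open>x\<close>, \<open>y\<close> because \<open>u\<close> is odd.\<close>
  have add: "u (x + y) = u x + u y" for x y
    using sublinear_add[OF u(1), of x y] sublinear_add[OF u(1), of "- x" "- y"]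
      neg[of "x + y"] neg[of x] neg[of y] by simp
  have scale: "u (c *\<^sub>R x) = c * u x" for c x
  proof (cases "c \<ge> 0")
    case False
    then show ?thesis
      using sublinear_scaleR[OF u(1), of "- c" x] neg[of "c *\<^sub>R x"] by simp
  qed (rule sublinear_scaleR[OF u(1)])
  have le: "u x \<le> p x" for x
    using le_funD[OF u(2), of x] p0(2)[of x] by simp
  have "- u x0 \<le> - p x0"
    using le_funD[OF u(2), of "- x0"] p0(3) neg[of x0] by simp
  with le[of x0] have "u x0 = p x0" by simp
  moreover have "linear u" by (rule linearI) (simp_all add: add scale)
  ultimately show ?thesis using le that by blast
qed

text \<open>Carries the real part and the imaginary unit of the complex numbers over to
  \<open>'k\<close> as \<open>R\<close> and \<open>J\<close>, so that later arguments need not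
  mention the isomorphism.\<close>

lemma real_or_complex_cases:
  obtains (real) R :: "'k::real_or_complex \<Rightarrow> real" where
      "linear R" "\<And>r. R (of_real r) = r" "\<And>c. R c \<le> norm c" "\<And>c. c = of_real (R c)"
    | (complex) R :: "'k::real_or_complex \<Rightarrow> real" and J :: "'k::real_or_complex" where
      "linear R" "\<And>r. R (of_real r) = r" "\<And>c. R c \<le> norm c"
      "\<And>b. R (J * of_real b) = 0"
      "\<And>c. \<exists>a b. c = of_real a + J * of_real b" "J * J = - 1"
proof -
  obtain f :: "'k \<Rightarrow> complex" where add: "\<And>x y. f (x + y) = f x + f y"
    and mult: "\<And>x y. f (x * y) = f x * f y" and scale: "\<And>r x. f (r *\<^sub>R x) = r *\<^sub>R f x"
    and norm: "\<And>x. norm (f x) = norm x" and range: "range f = \<real> \<or> range f = UNIV"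
    using real_or_complex by metis
  have lin: "linear f" by (rule linearI) (auto simp: add scale)
  have inj: "x = y" if "f x = f y" for x y
    using norm[of "x - y"] that linear_diff[OF lin, of x y] by simp
  \<comment> \<open>An idempotent of a field is 0 or 1, and \<open>f 1\<close> has norm 1.\<close>
  have "f 1 * f 1 = f 1" "f 1 \<noteq> 0" using mult[of 1 1] norm[of 1] by auto
  then have "f 1 = 1" by simp
  then have of_real: "f (of_real r) = of_real r" for r
    using scale[of r 1] by (simp add: of_real_def)
  have 1: "linear (\<lambda>c. Re (f c))" by (rule linearI) (auto simp: add scale)
  have 2: "Re (f c) \<le> norm c" for c using complex_Re_le_cmod[of "f c"] norm by simp
  from range show ?thesis
  proof
    assume "range f = \<real>"
    then have "f c = f (of_real (Re (f c)))" for c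
      unfolding of_real by (metis complex_is_Real_iff of_real_Re rangeI)
    then show ?thesis using real[OF 1 _ 2] inj of_real by (metis Re_complex_of_real)
  next
    assume "range f = UNIV"
    then obtain J where J: "f J = \<i>" by (metis surjD)
    have "c = of_real (Re (f c)) + J * of_real (Im (f c))" for c
      by (rule inj) (simp add: add mult of_real J complex_eq_iff)
    then have "\<exists>a b. c = of_real a + J * of_real b" for c by blast
    moreover have "J * J = - 1"
      by (rule inj) (simp add: linear_neg[OF lin] mult J \<open>f 1 = 1\<close>)
    moreover have "Re (f (J * of_real b)) = 0" for b by (simp add: mult J of_real)
    ultimately show ?thesis using complex[of "\<lambda>c. Re (f c)" J] 1 2 of_real by simp
  qed
qed

context banach_space_over
begin

text \<open>In the complex case this is the classical formula
  \<open>\<phi> x = u x - i * u (i * x)\<close>; over the reals \<open>\<phi>\<close> is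
  \<open>u\<close> itself, up to the embedding of the reals.\<close>

lemma real_linear_functional_is_real_part:
  assumes u: "linear (u :: 'x \<Rightarrow> real)"
  obtains \<phi> :: "'x \<Rightarrow> 'k" and R :: "'k \<Rightarrow> real" where
    "\<And>x y. \<phi> (x + y) = \<phi> x + \<phi> y" "\<And>c x. \<phi> (scaleK c x) = c * \<phi> x"
    "\<And>x. R (\<phi> x) = u x" "\<And>r. R (of_real r) = r" "\<And>c. R c \<le> norm c"
proof (cases rule: real_or_complex_cases[where ?'k = 'k])
  case (real R)
  define \<phi> :: "'x \<Rightarrow> 'k" where "\<phi> x = of_real (u x)" for x
  have "\<phi> (scaleK c x) = c * \<phi> x" for c x
    using scale_of_real[of "R c" x] real(4)[of c]
    by (metis \<phi>_def linear_cmul[OF u] of_real_mult real_scaleR_def)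
  then show ?thesis using that[of \<phi> R] real(2,3) by (simp add: \<phi>_def linear_add[OF u])
next
  case (complex R J)
  define \<phi> :: "'x \<Rightarrow> 'k" where "\<phi> x = of_real (u x) - J * of_real (u (scaleK J x))" for x
  have add: "\<phi> (x + y) = \<phi> x + \<phi> y" for x y
    by (simp add: \<phi>_def linear_add[OF u] scale_right_distrib algebra_simps)
  have real: "\<phi> (r *\<^sub>R x) = of_real r * \<phi> x" for r x
  proof -
    have "scaleK J (r *\<^sub>R x) = r *\<^sub>R scaleK J x"
      by (simp add: scale_left_commute flip: scale_of_real)
    then show ?thesis by (simp add: \<phi>_def linear_cmul[OF u] algebra_simps)
  qed
  have JJ: "scaleK J (scaleK J x) = - x" for x
    by (simp add: complex(6))
  have J: "\<phi> (scaleK J x) = J * \<phi> x" for x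
    by (simp add: \<phi>_def JJ linear_neg[OF u] right_diff_distrib complex(6) mult.assoc[symmetric])
  \<comment> \<open>Every scalar is \<open>a + J * b\<close> with real \<open>a\<close> and
    \<open>b\<close>, so homogeneity for reals and for \<open>J\<close> suffices.\<close>
  have "\<phi> (scaleK c x) = c * \<phi> x" for c x
  proof -
    obtain a b where c: "c = of_real a + J * of_real b"
      using complex(5) by blast
    have "scaleK c x = a *\<^sub>R x + scaleK J (b *\<^sub>R x)"
      unfolding c by (simp add: scale_left_distrib flip: scale_of_real)
    then show ?thesis by (simp add: add J real c algebra_simps)
  qed
  moreover have "R (\<phi> x) = u x" for x
    by (simp add: \<phi>_def linear_diff[OF complex(1)] complex(2,4))
  ultimately show ?thesis using that[of \<phi> R] add complex(2,3) by blast
qed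

text \<open>A real functional dominated by \<open>p\<close> is made the real part of
  \<open>\<phi>\<close>. Multiplying \<open>x\<close> by a scalar of modulus 1 makes
  \<open>\<phi> x\<close> real and nonnegative, so the bound on the real part becomes a bound on the
  norm.\<close>

theorem Hahn_Banach_seminorm:
  assumes add: "\<And>x y. p (x + y) \<le> p x + p y" and scale: "\<And>c x. p (scaleK c x) \<le> norm c * p x"
  obtains \<phi> :: "'x \<Rightarrow> 'k" where
    "\<And>x y. \<phi> (x + y) = \<phi> x + \<phi> y" "\<And>c x. \<phi> (scaleK c x) = c * \<phi> x"
    "\<And>x. norm (\<phi> x) \<le> p x" "p x0 \<le> norm (\<phi> x0)"
proof -
  have "sublinear p"
    unfolding sublinear_def using add scale[of "of_real _", unfolded scale_of_real]
    by (metis abs_of_nonneg norm_of_real)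
  then obtain u where u: "linear u" "\<And>x. u x \<le> p x" "u x0 = p x0"
    using Hahn_Banach_sublinear by blast
  obtain \<phi> :: "'x \<Rightarrow> 'k" and R where \<phi>: "\<And>x y. \<phi> (x + y) = \<phi> x + \<phi> y"
      "\<And>c x. \<phi> (scaleK c x) = c * \<phi> x"
    and R: "\<And>x. R (\<phi> x) = u x" "\<And>r. R (of_real r) = r" "\<And>c. R c \<le> norm c"
    using real_linear_functional_is_real_part[OF u(1)] by blast
  have "norm (\<phi> x) \<le> p x" for x
  proof -
    \<comment> \<open>The rotating scalar; the value 1 in the degenerate case keeps its norm equal
      to 1.\<close>
    define c where "c = (if \<phi> x = 0 then 1 else of_real (norm (\<phi> x)) / \<phi> x)"
    have c: "norm c = 1" "c * \<phi> x = of_real (norm (\<phi> x))"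
      by (auto simp: c_def norm_divide)
    have "norm (\<phi> x) = u (scaleK c x)"
      using R(1)[of "scaleK c x"] R(2)[of "norm (\<phi> x)"] by (simp add: \<phi>(2) c(2))
    also have "\<dots> \<le> p x"
      using u(2)[of "scaleK c x"] scale[of c x] c(1) by simp
    finally show ?thesis .
  qed
  moreover have "p x0 \<le> norm (\<phi> x0)" using R(1,3) u(3) by metis
  ultimately show ?thesis using that \<phi> by blast
qed

end

subsection \<open>Baire category and the gap between subspaces\<close>

text \<open>Baire's theorem is applied to \<open>L\<close> with its subspace topology, which is
  completely metrizable because \<open>L\<close> is closed. The traces on \<open>L\<close> of the
  closures cover \<open>L\<close>, so one of them has interior relative to \<open>L\<close>.\<close>

lemma closed_subset_UN_closure_interior:
  fixes L :: "'x::complete_space set" and A :: "nat \<Rightarrow> 'x set"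
  assumes "closed L" "L \<noteq> {}" "L \<subseteq> (\<Union>n. A n)"
  obtains n z r where "z \<in> L" "r > 0" "L \<inter> ball z r \<subseteq> closure (A n)"
proof -
  define T where "T n = L \<inter> closure (A n)" for n
  have "\<exists>n. top_of_set L interior_of T n \<noteq> {}"
  proof (rule ccontr)
    assume empty: "\<not> ?thesis"
    have "top_of_set L interior_of \<Union>(range T) = {}"
    proof (rule Baire_category_alt)
      have "completely_metrizable_space (top_of_set L)"
        by (intro completely_metrizable_space_closedin[OF completely_metrizable_space_euclidean]
            closed_closedin[THEN iffD1] assms(1))
      then show "completely_metrizable_space (top_of_set L) \<or>
          locally_compact_space (top_of_set L) \<and> regular_space (top_of_set L)" ..
      show "countable (range T)" by simp
      fix S assume "S \<in> range T"
      then show "closedin (top_of_set L) S \<and> top_of_set L interior_of S = {}"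
        using empty by (auto simp: T_def intro: closedin_closed_Int)
    qed
    moreover have "\<Union>(range T) = L"
    proof
      show "L \<subseteq> \<Union>(range T)"
        using assms(3) closure_subset unfolding T_def by blast
    qed (auto simp: T_def)
    ultimately show False
      using assms(2) interior_of_topspace[of "top_of_set L"] by simp
  qed
  then obtain n z where "z \<in> top_of_set L interior_of T n" by blast
  then obtain U where U: "openin (top_of_set L) U" "z \<in> U" "U \<subseteq> T n"
    by (auto simp: interior_of_def)
  then obtain r where "r > 0" "ball z r \<inter> L \<subseteq> U" by (meson openin_contains_ball)
  then show ?thesis using that[of z r n] U by (auto simp: T_def)
qed

text \<open>The unit vector in the direction of \<open>y\<close> has distance less than
  \<open>\<delta>\<close> to \<open>L\<close>. The strict inequality yields a point of
  \<open>L\<close> even if the distance is not attained; scaling back gives the claim.\<close>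

lemma rho0_approx:
  assumes Y: "subspace Y" and L: "subspace L" and rho: "rho0 Y L < \<delta>" and y: "y \<in> Y"
  obtains l where "l \<in> L" "norm (y - l) \<le> \<delta> * norm y"
proof (cases "y = 0")
  case True
  then show ?thesis using that[of 0] subspace_0[OF L] by simp
next
  case False
  define w where "w = y /\<^sub>R norm y"
  have w: "w \<in> Y" "norm w = 1"
    using False subspace_scale[OF Y y] by (simp_all add: w_def)
  have "Y \<noteq> {0}" using y False by blast
  have "infdist w L \<le> Sup {infdist y L | y. y \<in> Y \<and> norm y = 1}"
  proof (rule cSup_upper)
    show "bdd_above {infdist y L | y. y \<in> Y \<and> norm y = 1}"
    proof (rule bdd_aboveI)
      fix d assume "d \<in> {infdist y L | y. y \<in> Y \<and> norm y = 1}"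
      then obtain v where "d = infdist v L" "norm v = 1" by blast
      \<comment> \<open>The point 0 of \<open>L\<close> is at distance 1 from a unit vector.\<close>
      then show "d \<le> 1" using infdist_le[OF subspace_0[OF L], of v] by simp
    qed
    show "infdist w L \<in> {infdist y L | y. y \<in> Y \<and> norm y = 1}"
      using w by (intro CollectI exI[of _ w]) simp
  qed
  also have "\<dots> < \<delta>" using rho \<open>Y \<noteq> {0}\<close> by (simp add: rho0_def)
  finally have "infdist w L < \<delta>" .
  moreover have "L \<noteq> {}" using subspace_0[OF L] by blast
  moreover have "bdd_below (dist w ` L)" by (rule bdd_belowI2[of _ 0]) simp
  ultimately obtain l where l: "l \<in> L" "dist w l < \<delta>"
    by (auto simp: infdist_notempty cINF_less_iff)
  have "y - norm y *\<^sub>R l = norm y *\<^sub>R (w - l)"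
    using False by (simp add: w_def algebra_simps)
  then have "norm (y - norm y *\<^sub>R l) \<le> \<delta> * norm y"
    using l(2) mult_right_mono[of "norm (w - l)" \<delta> "norm y"] by (simp add: dist_norm mult.commute)
  then show ?thesis using that[of "norm y *\<^sub>R l"] subspace_scale[OF L l(1)] by blast
qed

subsection \<open>Finite and absolutely convergent representations\<close>

text \<open>The number is the cost of one particular representation, not an infimum. An index may
  occur repeatedly, so costs simply add up when representations are concatenated.\<close>

inductive finite_rep :: "'i set \<Rightarrow> ('i \<Rightarrow> 'x::real_normed_vector set) \<Rightarrow> real \<Rightarrow> 'x \<Rightarrow> bool"
  for \<Lambda> X where
  zero: "finite_rep \<Lambda> X 0 0"
| step: "finite_rep \<Lambda> X c x \<Longrightarrow> l \<in> \<Lambda> \<Longrightarrow> z \<in> X l \<Longrightarrow> finite_rep \<Lambda> X (c + norm z) (x + z)"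

lemma finite_rep_norm_le: "finite_rep \<Lambda> X c x \<Longrightarrow> norm x \<le> c"
proof (induction rule: finite_rep.induct)
  case (step c x l z)
  then show ?case using norm_triangle_ineq[of x z] by simp
qed simp

lemma finite_rep_nonneg: "finite_rep \<Lambda> X c x \<Longrightarrow> 0 \<le> c"
  using finite_rep_norm_le norm_ge_zero order_trans by blast

lemma finite_rep_add:
  assumes "finite_rep \<Lambda> X c x" "finite_rep \<Lambda> X d y"
  shows "finite_rep \<Lambda> X (c + d) (x + y)"
  using assms(2)
proof (induction rule: finite_rep.induct)
  case (step d y l z)
  then show ?case using finite_rep.step[of \<Lambda> X "c + d" "x + y" l z] by (simp add: add.assoc)
qed (simp add: assms(1))

lemma finite_rep_single: "l \<in> \<Lambda> \<Longrightarrow> z \<in> X l \<Longrightarrow> finite_rep \<Lambda> X (norm z) z"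
  using finite_rep.step[OF finite_rep.zero] by fastforce

text \<open>Terms with the same index are merged. By the triangle inequality this can only decrease
  the cost, hence the inequality in the last conclusion.\<close>

lemma finite_rep_imp_has_sum:
  assumes "finite_rep \<Lambda> X c x" and X: "\<And>l. l \<in> \<Lambda> \<Longrightarrow> subspace (X l)"
  obtains f where "\<And>l. l \<in> \<Lambda> \<Longrightarrow> f l \<in> X l" "(f has_sum x) \<Lambda>" "(\<lambda>l. norm (f l)) summable_on \<Lambda>"
    "(\<Sum>\<^sub>\<infinity>l\<in>\<Lambda>. norm (f l)) \<le> c"
proof -
  have "\<exists>f. (\<forall>l\<in>\<Lambda>. f l \<in> X l) \<and> (f has_sum x) \<Lambda> \<and> (\<lambda>l. norm (f l)) summable_on \<Lambda> \<and>
    (\<Sum>\<^sub>\<infinity>l\<in>\<Lambda>. norm (f l)) \<le> c"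
    using assms(1)
  proof (induction rule: finite_rep.induct)
    case zero
    show ?case using subspace_0[OF X] by (intro exI[of _ "\<lambda>_. 0"]) simp
  next
    case (step c x l z)
    then obtain f where f: "\<forall>l\<in>\<Lambda>. f l \<in> X l" "(f has_sum x) \<Lambda>" "(\<lambda>l. norm (f l)) summable_on \<Lambda>"
      "(\<Sum>\<^sub>\<infinity>l\<in>\<Lambda>. norm (f l)) \<le> c" by blast
    define g where "g m = (if m = l then z else 0)" for m
    have g: "(g has_sum z) \<Lambda>" "((\<lambda>m. norm (g m)) has_sum norm z) \<Lambda>"
      by (rule has_sum_finite_neutralI[of "{l}"]; use step.hyps in \<open>simp add: g_def\<close>)+
    have sum: "((\<lambda>m. norm (f m) + norm (g m)) has_sum (\<Sum>\<^sub>\<infinity>l\<in>\<Lambda>. norm (f l)) + norm z) \<Lambda>"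
      using f(3) g(2) by (intro has_sum_add) auto
    have abs: "(\<lambda>m. norm (f m + g m)) summable_on \<Lambda>"
      by (rule Infinite_Sum.abs_summable_on_comparison_test[of "\<lambda>m. norm (f m) + norm (g m)"])
        (use sum in \<open>auto simp: norm_triangle_ineq intro: has_sum_imp_summable\<close>)
    have "(\<Sum>\<^sub>\<infinity>m\<in>\<Lambda>. norm (f m + g m)) \<le> (\<Sum>\<^sub>\<infinity>m\<in>\<Lambda>. norm (f m) + norm (g m))"
      using abs sum by (intro infsum_mono) (auto simp: norm_triangle_ineq intro: has_sum_imp_summable)
    also have "\<dots> \<le> c + norm z" using infsumI[OF sum] f(4) by simp
    finally have "(\<Sum>\<^sub>\<infinity>m\<in>\<Lambda>. norm (f m + g m)) \<le> c + norm z" .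
    moreover have "\<forall>m\<in>\<Lambda>. f m + g m \<in> X m"
      using f(1) X step.hyps by (auto simp: g_def subspace_add)
    ultimately show ?case
      using has_sum_add[OF f(2) g(1)] abs by (intro exI[of _ "\<lambda>m. f m + g m"]) simp
  qed
  then show ?thesis using that by blast
qed

text \<open>Applying \<open>G\<close> to the successive errors halves them each time, so the
  corrections form a double family with geometrically decaying row sums. Summing it by index
  \<open>l\<close> first gives the desired family, summing it by step first gives
  \<open>x\<close>.\<close>

lemma has_sum_iterated_correction:
  fixes X :: "'i \<Rightarrow> 'x::banach set" and G :: "'x \<Rightarrow> 'i \<Rightarrow> 'x"
  assumes X: "\<And>l. l \<in> \<Lambda> \<Longrightarrow> subspace (X l) \<and> closed (X l)"
    and GX: "\<And>x l. l \<in> \<Lambda> \<Longrightarrow> G x l \<in> X l"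
    and Gabs: "\<And>x. (\<lambda>l. norm (G x l)) summable_on \<Lambda>"
    and Gle: "\<And>x. (\<Sum>\<^sub>\<infinity>l\<in>\<Lambda>. norm (G x l)) \<le> K * norm x"
    and half: "\<And>x. norm (x - infsum (G x) \<Lambda>) \<le> norm x / 2"
  obtains f where "\<And>l. l \<in> \<Lambda> \<Longrightarrow> f l \<in> X l" "(\<lambda>l. norm (f l)) summable_on \<Lambda>" "(f has_sum x) \<Lambda>"
proof -
  \<comment> \<open>The error left after \<open>n\<close> corrections.\<close>
  define r where "r n = ((\<lambda>v. v - infsum (G v) \<Lambda>) ^^ n) x" for n
  define F where "F n = G (r n)" for n
  define t where "t n = infsum (F n) \<Lambda>" for n
  have r0: "r 0 = x" and rSuc: "r (Suc n) = r n - t n" for n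
    by (simp_all add: r_def t_def F_def)
  have r: "norm (r n) \<le> norm x * (1/2) ^ n" for n
  proof (induction n)
    case (Suc n)
    then show ?case using half[of "r n"] by (simp add: rSuc t_def F_def)
  qed (simp add: r0)
  have "0 \<le> K * norm y" for y :: 'x
    using infsum_nonneg[of \<Lambda> "\<lambda>l. norm (G y l)"] Gle[of y] by auto
  \<comment> \<open>No sign of \<open>K\<close> is assumed, so the geometric majorant is built with
    \<open>\<bar>K\<bar>\<close>.\<close>
  then have K: "K * norm (r n) \<le> \<bar>K\<bar> * norm x * (1/2) ^ n" for n
    using r[of n] mult_mono[of K "\<bar>K\<bar>" "norm (r n)" "norm x * (1/2) ^ n"] by (simp add: mult.assoc)
  have geometric: "summable (\<lambda>n. \<bar>K\<bar> * norm x * (1/2) ^ n)"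
    by (intro summable_mult summable_geometric) simp
  have Fle: "(\<Sum>\<^sub>\<infinity>l\<in>\<Lambda>. norm (F n l)) \<le> \<bar>K\<bar> * norm x * (1/2) ^ n" for n
    using Gle[of "r n"] K[of n] by (simp add: F_def)
  have abs: "(\<lambda>z. norm (case z of (n, l) \<Rightarrow> F n l)) summable_on UNIV \<times> \<Lambda>"
  proof (subst Infinite_Sum.abs_summable_on_Sigma_iff, intro conjI ballI)
    show "(\<lambda>n. norm (\<Sum>\<^sub>\<infinity>l\<in>\<Lambda>. norm (case (n, l) of (n, l) \<Rightarrow> F n l))) summable_on UNIV"
    proof (rule Infinite_Sum.abs_summable_on_comparison_test[where g = "\<lambda>n. \<bar>K\<bar> * norm x * (1/2) ^ n"])
      show "(\<lambda>n. norm (\<bar>K\<bar> * norm x * (1/2) ^ n)) summable_on UNIV"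
        using geometric by (intro norm_summable_imp_summable_on) (simp add: abs_mult)
    qed (use Fle in \<open>simp add: infsum_nonneg\<close>)
  qed (simp add: F_def Gabs)
  then have abs': "(\<lambda>z. norm (case z of (l, n) \<Rightarrow> F n l)) summable_on \<Lambda> \<times> UNIV"
    by (subst summable_on_swap) (simp add: case_prod_unfold)
  define f where "f l = (\<Sum>\<^sub>\<infinity>n. F n l)" for l
  have Fabs: "(\<lambda>n. norm (F n l)) summable_on UNIV" if "l \<in> \<Lambda>" for l
    using abs' that by (simp add: Infinite_Sum.abs_summable_on_Sigma_iff)
  have fabs: "(\<lambda>l. norm (\<Sum>\<^sub>\<infinity>n. norm (F n l))) summable_on \<Lambda>"
    using abs' by (simp add: Infinite_Sum.abs_summable_on_Sigma_iff)
  have "f l \<in> X l" if "l \<in> \<Lambda>" for l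
  proof -
    have "((\<lambda>n. F n l) has_sum f l) UNIV"
      unfolding f_def by (rule has_sum_infsum[OF abs_summable_summable[OF Fabs[OF that]]])
    from has_sum_imp_sums[OF this] have lim: "(\<lambda>n. \<Sum>i<n. F i l) \<longlonglongrightarrow> f l"
      by (simp add: sums_def)
    \<comment> \<open>Closedness of \<open>X l\<close> carries membership from the partial sums to
      \<open>f l\<close>.\<close>
    have mem: "(\<Sum>i<n. F i l) \<in> X l" for n
      using X GX that by (intro subspace_sum) (auto simp: F_def)
    show ?thesis by (rule closed_sequentially[OF conjunct2[OF X[OF that]] mem lim])
  qed
  moreover have "(\<lambda>l. norm (f l)) summable_on \<Lambda>"
  proof (rule Infinite_Sum.abs_summable_on_comparison_test[OF fabs])
    fix l assume "l \<in> \<Lambda>"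
    then show "norm (f l) \<le> norm (\<Sum>\<^sub>\<infinity>n. norm (F n l))"
      unfolding f_def using norm_infsum_bound[OF Fabs, of l] by simp
  qed
  moreover have "infsum f \<Lambda> = x"
  proof -
    have "infsum f \<Lambda> = infsum t UNIV"
      unfolding f_def t_def by (rule infsum_swap_banach[OF abs_summable_summable[OF abs']])
    also have "(t has_sum x) UNIV"
    proof (rule norm_summable_imp_has_sum)
      have "norm (t n) \<le> \<bar>K\<bar> * norm x * (1/2) ^ n" for n
        using norm_infsum_bound[OF Gabs, of "r n"] Fle[of n] by (simp add: t_def F_def)
      then show "summable (\<lambda>n. norm (t n))"
        using geometric by (intro summable_comparison_test'[OF geometric]) simp
      \<comment> \<open>The corrections telescope, and the error tends to 0.\<close>
      have "(\<Sum>i<n. t i) = x - r n" for n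
        by (induction n) (simp_all add: r0 rSuc)
      moreover have "r \<longlonglongrightarrow> 0"
      proof (rule Lim_null_comparison)
        show "(\<lambda>n. norm x * (1/2) ^ n) \<longlonglongrightarrow> 0"
          by (intro tendsto_mult_right_zero LIMSEQ_power_zero) simp
      qed (simp add: r)
      ultimately show "t sums x"
        unfolding sums_def using tendsto_diff[of "\<lambda>_. x" x sequentially r 0] by simp
    qed
    then have "infsum t UNIV = x" by (rule infsumI)
    finally show ?thesis .
  qed
  ultimately show ?thesis
    using that[of f] has_sum_infsum[OF abs_summable_summable, of f \<Lambda>] by simp
qed

subsection \<open>Approximation by finite representations\<close>

context banach_space_over
begin

text \<open>The last conclusion passes from subspaces over \<open>'k\<close> to real subspaces, the
  notion used in the preceding lemmas; real scaling is \<open>scaleK\<close> at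
  \<open>of_real\<close>.\<close>

lemma closed_subspaceD:
  assumes "closed_subspace scaleK S"
  shows "closed S" "0 \<in> S" "x \<in> S \<Longrightarrow> y \<in> S \<Longrightarrow> x + y \<in> S" "x \<in> S \<Longrightarrow> scaleK c x \<in> S"
    "Real_Vector_Spaces.subspace S"
proof -
  have S: "closed S" "subspace S" using assms by (auto simp: closed_subspace_def)
  then show "closed S" "0 \<in> S" "x \<in> S \<Longrightarrow> y \<in> S \<Longrightarrow> x + y \<in> S" "x \<in> S \<Longrightarrow> scaleK c x \<in> S"
    by (auto simp: subspace_def)
  show "Real_Vector_Spaces.subspace S"
    using S(2) unfolding subspace_def Real_Vector_Spaces.subspace_def scale_of_real[symmetric] by blast
qed

context
  fixes \<Lambda> :: "'i set" and X :: "'i \<Rightarrow> 'x set"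
  assumes X: "\<And>l. l \<in> \<Lambda> \<Longrightarrow> closed_subspace scaleK (X l)"
begin

lemma finite_rep_scale:
  assumes "finite_rep \<Lambda> X c x"
  shows "finite_rep \<Lambda> X (norm k * c) (scaleK k x)"
  using assms
proof (induction rule: finite_rep.induct)
  case zero
  then show ?case using finite_rep.zero by simp
next
  case (step c x l z)
  then show ?case
    using finite_rep.step[OF step.IH step.hyps(2), of "scaleK k z"] closed_subspaceD(4)[OF X]
    by (simp add: norm_scale scale_right_distrib distrib_left)
qed

lemma finite_rep_scaleR:
  assumes "finite_rep \<Lambda> X c x"
  shows "finite_rep \<Lambda> X (\<bar>t\<bar> * c) (t *\<^sub>R x)"
  using finite_rep_scale[OF assms, of "of_real t"] by (simp add: scale_of_real)

lemma span_imp_finite_rep: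
  assumes "x \<in> span (\<Union>l\<in>\<Lambda>. X l)"
  shows "\<exists>c. finite_rep \<Lambda> X c x"
  using assms
proof (induction rule: span_induct_alt)
  case base
  show ?case using finite_rep.zero by blast
next
  case (step k x y)
  then obtain l c where "l \<in> \<Lambda>" "x \<in> X l" "finite_rep \<Lambda> X c y" by blast
  then show ?case
    using finite_rep_add[OF finite_rep_single[of l \<Lambda> "scaleK k x" X]] closed_subspaceD(4)[OF X]
    by blast
qed

text \<open>By Baire some \<open>A n\<close> is dense in a ball of \<open>L\<close> around
  \<open>z\<close>. Subtracting an approximation of \<open>z\<close> from one of
  \<open>z + t *\<^sub>R x\<close> and dividing by \<open>t\<close> approximates \<open>x\<close>.
  The cost is at most \<open>2 * n / t\<close>, whatever the precision \<open>e\<close>.\<close>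

lemma finite_rep_dense_in_closed_subspace:
  assumes L: "closed_subspace scaleK L" "L \<subseteq> span (\<Union>l\<in>\<Lambda>. X l)"
  obtains K where "K \<ge> 0"
    "\<And>x e. x \<in> L \<Longrightarrow> e > 0 \<Longrightarrow> \<exists>c d. finite_rep \<Lambda> X c d \<and> c \<le> K * norm x \<and> norm (x - d) < e"
proof -
  define A where "A n = {x. \<exists>c \<le> real n. finite_rep \<Lambda> X c x}" for n
  have "L \<subseteq> (\<Union>n. A n)"
  proof
    fix x assume "x \<in> L"
    with L(2) obtain c where c: "finite_rep \<Lambda> X c x" using span_imp_finite_rep by blast
    obtain n where "c \<le> real n" using real_arch_simple by blast
    with c show "x \<in> (\<Union>n. A n)" by (auto simp: A_def)
  qed
  moreover have "L \<noteq> {}" using closed_subspaceD(2)[OF L(1)] by blast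
  ultimately obtain z r n where z: "z \<in> L" and "r > 0" and zr: "L \<inter> ball z r \<subseteq> closure (A n)"
    using closed_subset_UN_closure_interior[OF closed_subspaceD(1)[OF L(1)]] by metis
  have "\<exists>c d. finite_rep \<Lambda> X c d \<and> c \<le> (4 * n / r) * norm x \<and> norm (x - d) < e"
    if "x \<in> L" "e > 0" for x e
  proof (cases "x = 0")
    case True
    with \<open>e > 0\<close> show ?thesis using finite_rep.zero by fastforce
  next
    case False
    \<comment> \<open>Moves \<open>z\<close> by exactly \<open>r / 2\<close>, inside the ball, and
      makes \<open>2 * n / t\<close> equal to \<open>(4 * n / r) * norm x\<close>.\<close>
    define t where "t = r / (2 * norm x)"
    have "t > 0" using False \<open>r > 0\<close> by (simp add: t_def)
    have "norm (t *\<^sub>R x) < r" using False \<open>r > 0\<close> by (simp add: t_def)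
    moreover have "z + t *\<^sub>R x \<in> L"
      using closed_subspaceD(5)[OF L(1)] z \<open>x \<in> L\<close>
      by (simp add: Real_Vector_Spaces.subspace_add Real_Vector_Spaces.subspace_scale)
    ultimately have "z + t *\<^sub>R x \<in> closure (A n)" "z \<in> closure (A n)"
      using zr z \<open>r > 0\<close> by (auto simp: dist_norm)
    \<comment> \<open>Two errors below \<open>t * e / 2\<close> leave an error below
      \<open>e\<close> after division by \<open>t\<close>.\<close>
    moreover have "t * e / 2 > 0" using \<open>t > 0\<close> \<open>e > 0\<close> by simp
    ultimately obtain d1 d2 where "d1 \<in> A n" "dist d1 (z + t *\<^sub>R x) < t * e / 2"
      "d2 \<in> A n" "dist d2 z < t * e / 2"
      unfolding closure_approachable by meson
    then obtain c1 c2 where d: "finite_rep \<Lambda> X c1 d1" "finite_rep \<Lambda> X c2 d2"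
      and c: "c1 \<le> n" "c2 \<le> n" and near: "norm (d1 - (z + t *\<^sub>R x)) < t * e / 2" "norm (d2 - z) < t * e / 2"
      by (auto simp: A_def dist_norm)
    define d where "d = (1 / t) *\<^sub>R (d1 + (- 1) *\<^sub>R d2)"
    have "finite_rep \<Lambda> X (\<bar>1 / t\<bar> * (c1 + \<bar>- 1\<bar> * c2)) d"
      unfolding d_def by (intro finite_rep_scaleR finite_rep_add d)
    moreover have "\<bar>1 / t\<bar> * (c1 + \<bar>- 1\<bar> * c2) \<le> (4 * n / r) * norm x"
    proof -
      have "\<bar>1 / t\<bar> * (c1 + \<bar>- 1\<bar> * c2) \<le> (1 / t) * (2 * n)"
        using c \<open>t > 0\<close> by (simp add: divide_right_mono)
      also have "\<dots> = (4 * n / r) * norm x"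
        using False by (simp add: t_def)
      finally show ?thesis .
    qed
    moreover have "norm (x - d) < e"
    proof -
      have "t *\<^sub>R (x - d) = (d2 - z) - (d1 - (z + t *\<^sub>R x))"
        using \<open>t > 0\<close> by (simp add: d_def algebra_simps)
      then have "norm (t *\<^sub>R (x - d)) < t * e"
        using norm_triangle_ineq4[of "d2 - z" "d1 - (z + t *\<^sub>R x)"] near by simp
      then show ?thesis using \<open>t > 0\<close> by simp
    qed
    ultimately show ?thesis by blast
  qed
  moreover have "4 * n / r \<ge> 0" using \<open>r > 0\<close> by simp
  ultimately show ?thesis using that by blast
qed

text \<open>The hypothesis is applied to a Hahn-Banach functional for the seminorm
  \<open>p x = inf {c + M * norm (x - d - y)}\<close>, where \<open>d\<close> is a finite sum of cost \<open>c\<close> and \<open>y \<in> Y\<close>. Such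
  a functional vanishes on \<open>Y\<close> and has norm at most 1 on each \<open>X l\<close>, so \<open>\<epsilon> * p x \<le> norm x\<close>,
  whatever \<open>M\<close> is.\<close>

lemma finite_rep_approx_modulo:
  assumes "\<Lambda> \<noteq> {}"
    and Y: "closed_subspace scaleK Y" and "\<epsilon> > 0" "M > 0"
    and ann: "\<And>\<phi>. \<phi> \<in> annihilator scaleK Y \<Longrightarrow> (SUP l\<in>\<Lambda>. onorm_on (X l) \<phi>) \<ge> \<epsilon> * onorm \<phi>"
    and "x \<noteq> 0"
  obtains c d y where "finite_rep \<Lambda> X c d" "y \<in> Y" "c + M * norm (x - d - y) \<le> (2 / \<epsilon>) * norm x"
proof -
  define S where "S x = {c + M * norm (x - d - y) | c d y. finite_rep \<Lambda> X c d \<and> y \<in> Y}" for x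
  define p where "p x = Inf (S x)" for x
  have SI: "c + M * norm (x - d - y) \<in> S x" if "finite_rep \<Lambda> X c d" "y \<in> Y" for c d y x
    using that by (auto simp: S_def)
  have bdd: "bdd_below (S x)" for x
    using finite_rep_nonneg \<open>M > 0\<close> by (fastforce simp: S_def intro: bdd_belowI[of _ 0])
  have p_le: "p x \<le> m" if "m \<in> S x" for x m
    unfolding p_def by (rule cInf_lower[OF that bdd])
  have nonempty: "S x \<noteq> {}" for x
    using SI[OF finite_rep.zero closed_subspaceD(2)[OF Y]] by blast
  have p_ge: "m \<le> p x" if "\<And>a. a \<in> S x \<Longrightarrow> m \<le> a" for x m
    unfolding p_def by (rule cInf_greatest[OF nonempty that])
  \<comment> \<open>The trivial choice \<open>d = 0\<close>, \<open>y = 0\<close>; it makes the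
    functional below bounded.\<close>
  have p_norm: "p x \<le> M * norm x" for x
    using p_le[OF SI[OF finite_rep.zero closed_subspaceD(2)[OF Y]], of x] by simp
  have p_add: "p (x + z) \<le> p x + p z" for x z
  proof -
    have *: "p (x + z) \<le> a + b" if a: "a \<in> S x" and b: "b \<in> S z" for a b
    proof -
      obtain c d y where a: "a = c + M * norm (x - d - y)" "finite_rep \<Lambda> X c d" "y \<in> Y"
        using a by (auto simp: S_def)
      obtain c' d' y' where b: "b = c' + M * norm (z - d' - y')" "finite_rep \<Lambda> X c' d'" "y' \<in> Y"
        using b by (auto simp: S_def)
      have "p (x + z) \<le> c + c' + M * norm (x + z - (d + d') - (y + y'))"
        by (intro p_le SI finite_rep_add a b closed_subspaceD(3)[OF Y])
      also have "x + z - (d + d') - (y + y') = (x - d - y) + (z - d' - y')" by simp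
      also have "M * norm \<dots> \<le> M * (norm (x - d - y) + norm (z - d' - y'))"
        using \<open>M > 0\<close> by (intro mult_left_mono norm_triangle_ineq) simp
      finally show ?thesis by (simp add: a b algebra_simps)
    qed
    have "p (x + z) - b \<le> p x" if "b \<in> S z" for b
      using *[OF _ that] by (intro p_ge) (simp add: algebra_simps)
    then have "p (x + z) - p x \<le> p z"
      by (intro p_ge) (simp add: algebra_simps)
    then show ?thesis by simp
  qed
  have p_scale: "p (scaleK k x) \<le> norm k * p x" for k x
  proof (cases "k = 0")
    case True
    then show ?thesis using p_norm[of 0] by simp
  next
    case False
    have "p (scaleK k x) / norm k \<le> p x"
    proof (rule p_ge)
      fix a assume "a \<in> S x"
      then obtain c d y where a: "a = c + M * norm (x - d - y)" "finite_rep \<Lambda> X c d" "y \<in> Y"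
        by (auto simp: S_def)
      have "p (scaleK k x) \<le> norm k * c + M * norm (scaleK k x - scaleK k d - scaleK k y)"
        by (intro p_le SI finite_rep_scale a closed_subspaceD(4)[OF Y])
      also have "scaleK k x - scaleK k d - scaleK k y = scaleK k (x - d - y)"
        by (simp only: scale_right_diff_distrib)
      also have "norm k * c + M * norm \<dots> = norm k * a"
        unfolding a norm_scale by (simp add: distrib_left mult.left_commute)
      finally have "p (scaleK k x) \<le> norm k * a" .
      then show "p (scaleK k x) / norm k \<le> a"
        using False by (simp add: pos_divide_le_eq mult.commute)
    qed
    with False show ?thesis by (simp add: field_simps)
  qed
  obtain \<phi> :: "'x \<Rightarrow> 'k" where \<phi>: "\<And>x y. \<phi> (x + y) = \<phi> x + \<phi> y"
      "\<And>c x. \<phi> (scaleK c x) = c * \<phi> x" "\<And>x. norm (\<phi> x) \<le> p x" "p x \<le> norm (\<phi> x)"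
    by (rule Hahn_Banach_seminorm[of p x]) (use p_add p_scale in blast)+
  have bl: "bounded_linear \<phi>"
  proof (rule bounded_linear_intro)
    show "\<phi> (r *\<^sub>R x) = r *\<^sub>R \<phi> x" for r x
      using \<phi>(2)[of "of_real r" x] by (simp add: scale_of_real scaleR_conv_of_real)
    show "norm (\<phi> x) \<le> norm x * M" for x
      using \<phi>(3)[of x] p_norm[of x] by (simp add: mult.commute)
  qed (rule \<phi>(1))
  \<comment> \<open>Taking \<open>d = 0\<close> and \<open>y\<close> itself as the element of
    \<open>Y\<close> gives \<open>p y \<le> 0\<close>.\<close>
  have "\<phi> y = 0" if "y \<in> Y" for y
  proof -
    have "norm (\<phi> y) \<le> 0"
      using order_trans[OF \<phi>(3) p_le[OF SI[OF finite_rep.zero that]], of y] by simp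
    then show ?thesis by simp
  qed
  then have "\<phi> \<in> annihilator scaleK Y"
    unfolding annihilator_def dual_space_def using bl \<phi>(2) by blast
  then have "\<epsilon> * onorm \<phi> \<le> (SUP l\<in>\<Lambda>. onorm_on (X l) \<phi>)" by (rule ann)
  also have "\<dots> \<le> 1"
  proof (rule cSUP_least[OF \<open>\<Lambda> \<noteq> {}\<close>])
    fix l assume l: "l \<in> \<Lambda>"
    show "onorm_on (X l) \<phi> \<le> 1"
      unfolding onorm_on_def
    proof (rule cSUP_least)
      fix z assume "z \<in> X l"
      \<comment> \<open>The one-term representation of \<open>z\<close> leaves no error, so
        \<open>p z \<le> norm z\<close>.\<close>
      then have "finite_rep \<Lambda> X (norm z) z" by (rule finite_rep_single[OF l])
      from order_trans[OF \<phi>(3) p_le[OF SI[OF this closed_subspaceD(2)[OF Y]]], of z]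
      have "norm (\<phi> z) \<le> norm z" by simp
      then show "norm (\<phi> z) / norm z \<le> 1" by (simp add: divide_le_eq_1)
    next
      show "X l \<noteq> {}" using closed_subspaceD(2)[OF X[OF l]] by blast
    qed
  qed
  finally have "onorm \<phi> \<le> 1 / \<epsilon>" using \<open>\<epsilon> > 0\<close> by (simp add: field_simps)
  have "p x \<le> onorm \<phi> * norm x" using \<phi>(4) onorm[OF bl, of x] by simp
  also have "\<dots> \<le> 1 / \<epsilon> * norm x" by (rule mult_right_mono[OF \<open>onorm \<phi> \<le> 1 / \<epsilon>\<close>]) simp
  \<comment> \<open>Doubling the constant makes the inequality strict, as
    \<open>x \<noteq> 0\<close>, so some element of \<open>S x\<close> lies below the bound even if
    the infimum is not attained.\<close>
  also have "\<dots> < (2 / \<epsilon>) * norm x" using \<open>\<epsilon> > 0\<close> \<open>x \<noteq> 0\<close> by (simp add: field_simps)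
  finally obtain a where "a \<in> S x" and a: "a < (2 / \<epsilon>) * norm x"
    unfolding p_def using cInf_lessD[OF nonempty[of x]] by blast
  from \<open>a \<in> S x\<close> obtain c d y where "a = c + M * norm (x - d - y)" "finite_rep \<Lambda> X c d" "y \<in> Y"
    by (auto simp: S_def)
  then show ?thesis using that[of c d y] a by simp
qed

text \<open>The error budget is \<open>1/4\<close> from the approximation modulo \<open>Y\<close>,
  \<open>1/8\<close> from replacing \<open>y\<close> in \<open>Y\<close> by \<open>l\<close> in
  \<open>L\<close>, and \<open>1/8\<close> from representing \<open>l\<close>, all relative to
  \<open>norm x\<close>. Since \<open>L\<close> is fixed before \<open>x\<close>, one constant
  \<open>K\<close> serves all \<open>x\<close>.\<close>

lemma finite_rep_approx_half:
  assumes "\<Lambda> \<noteq> {}"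
    and Y: "closed_subspace scaleK Y" and "\<epsilon> > 0"
    and ann: "\<And>\<phi>. \<phi> \<in> annihilator scaleK Y \<Longrightarrow> (SUP l\<in>\<Lambda>. onorm_on (X l) \<phi>) \<ge> \<epsilon> * onorm \<phi>"
    and near: "\<And>\<delta>::real. \<delta> > 0 \<Longrightarrow>
      \<exists>L. closed_subspace scaleK L \<and> L \<subseteq> span (\<Union>l\<in>\<Lambda>. X l) \<and> rho0 Y L < \<delta>"
  obtains K where
    "\<And>x. \<exists>c d. finite_rep \<Lambda> X c d \<and> c \<le> K * norm x \<and> norm (x - d) \<le> norm x / 2"
proof -
  \<comment> \<open>Bounds \<open>norm y / norm x\<close> below: 1 for \<open>x\<close>,
    \<open>2 / \<epsilon>\<close> for \<open>d\<close>, and \<open>1/4\<close> for the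
    error.\<close>
  define B where "B = 5 / 4 + 2 / \<epsilon>"
  have "B > 0" using \<open>\<epsilon> > 0\<close> by (simp add: B_def add_pos_pos)
  then obtain L where L: "closed_subspace scaleK L" "L \<subseteq> span (\<Union>l\<in>\<Lambda>. X l)"
    and rho: "rho0 Y L < 1 / (8 * B)"
    using near[of "1 / (8 * B)"] by auto
  obtain K where K: "K \<ge> 0" "\<And>x e. x \<in> L \<Longrightarrow> e > 0 \<Longrightarrow>
      \<exists>c d. finite_rep \<Lambda> X c d \<and> c \<le> K * norm x \<and> norm (x - d) < e"
    using finite_rep_dense_in_closed_subspace[OF L] by blast
  have "\<exists>c d. finite_rep \<Lambda> X c d \<and> c \<le> (2 / \<epsilon> + K * (B + 1 / 8)) * norm x \<and>
      norm (x - d) \<le> norm x / 2" for x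
  proof (cases "x = 0")
    case True
    then show ?thesis using finite_rep.zero by fastforce
  next
    case False
    \<comment> \<open>This weight \<open>M\<close> on the error is four times the cost bound
      \<open>2 / \<epsilon>\<close>, which forces the error down to
      \<open>norm x / 4\<close>.\<close>
    have "8 / \<epsilon> > 0" using \<open>\<epsilon> > 0\<close> by simp
    then obtain c d y where d: "finite_rep \<Lambda> X c d" and y: "y \<in> Y"
      and le: "c + (8 / \<epsilon>) * norm (x - d - y) \<le> (2 / \<epsilon>) * norm x"
      using finite_rep_approx_modulo[OF \<open>\<Lambda> \<noteq> {}\<close> Y \<open>\<epsilon> > 0\<close> _ ann False] by blast
    have c: "c \<le> (2 / \<epsilon>) * norm x"
      using le \<open>8 / \<epsilon> > 0\<close> by (smt (verit) mult_nonneg_nonneg norm_ge_zero)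
    have "(8 / \<epsilon>) * norm (x - d - y) \<le> (2 / \<epsilon>) * norm x"
      using le finite_rep_nonneg[OF d] by simp
    then have r: "norm (x - d - y) \<le> norm x / 4" using \<open>\<epsilon> > 0\<close> by (simp add: field_simps)
    have "y = x - d - (x - d - y)" by simp
    then have "norm y \<le> norm x + norm d + norm (x - d - y)"
      using norm_triangle_ineq4[of "x - d" "x - d - y"] norm_triangle_ineq4[of x d] by simp
    also have "\<dots> \<le> B * norm x"
      using r c finite_rep_norm_le[OF d] by (simp add: B_def algebra_simps)
    finally have yB: "norm y \<le> B * norm x" .
    obtain l where l: "l \<in> L" "norm (y - l) \<le> 1 / (8 * B) * norm y"
      using rho0_approx[OF closed_subspaceD(5)[OF Y] closed_subspaceD(5)[OF L(1)] rho y] by blast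
    have "1 / (8 * B) * norm y \<le> norm x / 8" using yB \<open>B > 0\<close> by (simp add: field_simps)
    with l have yl: "norm (y - l) \<le> norm x / 8" by simp
    have "norm l \<le> norm y + norm (y - l)" using norm_triangle_ineq4[of y "y - l"] by simp
    with yl yB have lB: "norm l \<le> (B + 1 / 8) * norm x" by (simp add: algebra_simps)
    have "norm x / 8 > 0" using False by simp
    then obtain c' d' where d': "finite_rep \<Lambda> X c' d'" "c' \<le> K * norm l"
      and ld': "norm (l - d') < norm x / 8"
      using K(2)[OF l(1)] by blast
    have "c' \<le> K * (B + 1 / 8) * norm x"
      using d'(2) mult_left_mono[OF lB K(1)] by (simp add: mult.assoc)
    with c have "c + c' \<le> (2 / \<epsilon> + K * (B + 1 / 8)) * norm x" by (simp add: distrib_right)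
    moreover have "norm (x - (d + d')) \<le> norm x / 2"
    proof -
      have "norm (x - (d + d')) = norm ((x - d - y) + (y - l) + (l - d'))" by (simp add: algebra_simps)
      then show ?thesis
        using norm_triangle_ineq[of "x - d - y + (y - l)" "l - d'"]
          norm_triangle_ineq[of "x - d - y" "y - l"] r yl ld' by linarith
    qed
    ultimately show ?thesis using finite_rep_add[OF d d'(1)] by blast
  qed
  then show ?thesis using that by blast
qed

lemma ARFS_of_annihilator_bound:
  assumes "\<Lambda> \<noteq> {}"
    and Y: "closed_subspace scaleK Y" and "\<epsilon> > 0"
    and ann: "\<And>\<phi>. \<phi> \<in> annihilator scaleK Y \<Longrightarrow> (SUP l\<in>\<Lambda>. onorm_on (X l) \<phi>) \<ge> \<epsilon> * onorm \<phi>"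
    and near: "\<And>\<delta>::real. \<delta> > 0 \<Longrightarrow>
      \<exists>L. closed_subspace scaleK L \<and> L \<subseteq> span (\<Union>l\<in>\<Lambda>. X l) \<and> rho0 Y L < \<delta>"
  shows "ARFS scaleK \<Lambda> X"
proof -
  obtain K where K:
    "\<And>x. \<exists>c d. finite_rep \<Lambda> X c d \<and> c \<le> K * norm x \<and> norm (x - d) \<le> norm x / 2"
    using finite_rep_approx_half[OF \<open>\<Lambda> \<noteq> {}\<close> Y \<open>\<epsilon> > 0\<close> ann near] by blast
  have "\<exists>g. (\<forall>l\<in>\<Lambda>. g l \<in> X l) \<and> (\<lambda>l. norm (g l)) summable_on \<Lambda> \<and>
    (\<Sum>\<^sub>\<infinity>l\<in>\<Lambda>. norm (g l)) \<le> K * norm x \<and> norm (x - infsum g \<Lambda>) \<le> norm x / 2" for x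
  proof -
    obtain c d where d: "finite_rep \<Lambda> X c d" "c \<le> K * norm x" "norm (x - d) \<le> norm x / 2"
      using K by blast
    obtain g where "\<And>l. l \<in> \<Lambda> \<Longrightarrow> g l \<in> X l" "(g has_sum d) \<Lambda>" "(\<lambda>l. norm (g l)) summable_on \<Lambda>"
      "(\<Sum>\<^sub>\<infinity>l\<in>\<Lambda>. norm (g l)) \<le> c"
      using finite_rep_imp_has_sum[OF d(1) closed_subspaceD(5)[OF X]] by blast
    with d show ?thesis by (intro exI[of _ g]) (auto simp: infsumI)
  qed
  \<comment> \<open>One absolutely summable family is chosen for each vector, giving the correction
    map to be iterated.\<close>
  then obtain G where G: "\<And>x l. l \<in> \<Lambda> \<Longrightarrow> G x l \<in> X l" "\<And>x. (\<lambda>l. norm (G x l)) summable_on \<Lambda>"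
    "\<And>x. (\<Sum>\<^sub>\<infinity>l\<in>\<Lambda>. norm (G x l)) \<le> K * norm x" "\<And>x. norm (x - infsum (G x) \<Lambda>) \<le> norm x / 2"
    by metis
  have "\<exists>f. (\<forall>l\<in>\<Lambda>. f l \<in> X l) \<and> (\<lambda>l. norm (f l)) summable_on \<Lambda> \<and> (f has_sum x) \<Lambda>" for x
  proof -
    have sub: "Real_Vector_Spaces.subspace (X l) \<and> closed (X l)" if "l \<in> \<Lambda>" for l
      using closed_subspaceD(1,5)[OF X[OF that]] by simp
    obtain f where "\<And>l. l \<in> \<Lambda> \<Longrightarrow> f l \<in> X l" "(\<lambda>l. norm (f l)) summable_on \<Lambda>" "(f has_sum x) \<Lambda>"
      by (rule has_sum_iterated_correction[of \<Lambda> X G K x]) (use G sub in blast)+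
    then show ?thesis by blast
  qed
  then show ?thesis using X by (simp add: ARFS_def)
qed

end

end

theorem theorem6p1:
  fixes scaleK :: "'k::real_or_complex \<Rightarrow> 'x::banach \<Rightarrow> 'x"
    and \<Lambda> :: "'i set"
    and X :: "'i \<Rightarrow> 'x set"
    and Y :: "'x set"
  assumes "banach_space_over scaleK"
    and "\<Lambda> \<noteq> {}"
    and "\<And>l. l \<in> \<Lambda> \<Longrightarrow> closed_subspace scaleK (X l)"
    and "closed_subspace scaleK Y"
    and "\<And>\<delta>::real. \<delta> > 0 \<Longrightarrow>
      \<exists>L. closed_subspace scaleK L \<and> L \<subseteq> module.span scaleK (\<Union>l\<in>\<Lambda>. X l) \<and> rho0 Y L < \<delta>"
    and "\<exists>\<epsilon>::real. \<epsilon> > 0 \<and>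
      (\<forall>\<phi>\<in>annihilator scaleK Y. (SUP l\<in>\<Lambda>. onorm_on (X l) \<phi>) \<ge> \<epsilon> * onorm \<phi>)"
  shows "ARFS scaleK \<Lambda> X"
proof -
  interpret banach_space_over scaleK by (rule assms(1))
  obtain \<epsilon> :: real where "\<epsilon> > 0"
    and ann: "\<And>\<phi>. \<phi> \<in> annihilator scaleK Y \<Longrightarrow> (SUP l\<in>\<Lambda>. onorm_on (X l) \<phi>) \<ge> \<epsilon> * onorm \<phi>"
    using assms(6) by blast
  show ?thesis
    by (rule ARFS_of_annihilator_bound[OF assms(3,2,4) \<open>\<epsilon> > 0\<close> ann assms(5)])
qed

end
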